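(* Let $r\ge1$ and write $r=2s+\epsilon$ with $\epsilon\in\{0,1\}$. Then $$P_{r+1}(\{a\})=\Big(\prod_{i=1-\epsilon}^{s}U_{2i+\epsilon}\big(1,1,(-1)^{\epsilon+1}a_{2(s-i)+1}\big)\Big)\,P\,\Big(\prod_{i=1}^{s}U_{2i}(1,1,a_{2i})\Big),$$ where the factors within each product commute.
   Context: For $i\in[1,r]$ and nonzero $a,b,c$, $U_i(a,b,c)$ (resp. $V_i(a,b,c)$) is the $(r+1)\times(r+1)$ identity matrix except that its block in rows/columns $i,i+1$ is $\begin{pmatrix}1&0\\ c/b& a/b\end{pmatrix}$ (resp. $\begin{pmatrix}b/c& a/c\\ 0&1\end{pmatrix}$). $P$ is the $(r+1)\times(r+1)$ matrix with entries $P_{i,j}=(-1)^{(r-1)(i-1)}\delta_{i+j,r+2}$. With $a_1,\dots,a_r$ indeterminates, the array $(a_{i,-j})_{i,j\in[0,r+1]}$ is defined by $a_{i,0}=1$, $a_{0,-j}=a_{r+1,-j}=1$, $a_{i,-1}=a_i$ ($i\in[1,r]$), and $a_{i-1,-j}a_{i+1,-j}+a_{i,-j-1}a_{i,-j+1}=0$ for $i,j\in[1,r]$. For $i\in[1,r]$, $k\in[-r,0]$: $N_{i,k}(\{a\})=U_i(a_{i,k-1},a_{i,k},a_{i+1,k-1})$ if $i+k$ odd, $N_{i,k}(\{a\})=V_i(a_{i-1,k},a_{i,k-1},a_{i,k})$ if $i+k$ even. Finally $P_{r+1}(\{a\})=\prod_{k=-r}^{0}\big(N_{1,k}(\{a\})\cdots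 N_{r,k}(\{a\})\big)$ with factors ordered left to right by increasing $k$. *)

theory Defs
  imports "Jordan_Normal_Form.Matrix"
begin

text \<open>Matrices in \<^typ>\<open>'k mat\<close> are indexed from 0; \<open>mat1 n f\<close> is the \<open>n \<times> n\<close> matrix whose entry in
  row \<open>p\<close> and column \<open>q\<close>, both counted from 1, is \<open>f p q\<close>.\<close>

definition mat1 :: "nat \<Rightarrow> (nat \<Rightarrow> nat \<Rightarrow> 'k) \<Rightarrow> 'k mat" where
  "mat1 n f = mat n n (\<lambda>(p, q). f (p + 1) (q + 1))"

definition U_mat :: "nat \<Rightarrow> nat \<Rightarrow> 'k::field \<Rightarrow> 'k \<Rightarrow> 'k \<Rightarrow> 'k mat" where
  "U_mat r i a b c = mat1 (r + 1) (\<lambda>p q.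
     if p = i + 1 \<and> q = i then c / b
     else if p = i + 1 \<and> q = i + 1 then a / b
     else if p = q then 1 else 0)"

definition V_mat :: "nat \<Rightarrow> nat \<Rightarrow> 'k::field \<Rightarrow> 'k \<Rightarrow> 'k \<Rightarrow> 'k mat" where
  "V_mat r i a b c = mat1 (r + 1) (\<lambda>p q.
     if p = i \<and> q = i then b / c
     else if p = i \<and> q = i + 1 then a / c
     else if p = q then 1 else 0)"

definition P_mat :: "nat \<Rightarrow> 'k::field mat" where
  "P_mat r = mat1 (r + 1) (\<lambda>p q. if p + q = r + 2 then (-1) ^ ((r - 1) * (p - 1)) else 0)"

text \<open>Ordered product, leftmost factor first; type \<^typ>\<open>'k mat\<close> has no unit independent of the
  dimension, so \<open>prod_list\<close> is not applicable.\<close>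

definition mat_prod :: "nat \<Rightarrow> 'k::field mat list \<Rightarrow> 'k mat" where
  "mat_prod n Ms = foldr (*) Ms (1\<^sub>m n)"

text \<open>\<open>A i k\<close> stands for $a_{i,k}$, where \<open>k\<close> is the non-positive second index. Only the entries with
  \<open>i \<in> [0, r + 1]\<close> and \<open>k \<in> [-r - 1, 0]\<close> are constrained.\<close>

definition a_array :: "nat \<Rightarrow> (nat \<Rightarrow> 'k::field) \<Rightarrow> (nat \<Rightarrow> int \<Rightarrow> 'k) \<Rightarrow> bool" where
  "a_array r a A \<longleftrightarrow>
     (\<forall>i\<in>{0..r+1}. A i 0 = 1) \<and>
     (\<forall>j\<in>{0..r+1}. A 0 (- int j) = 1 \<and> A (r + 1) (- int j) = 1) \<and>
     (\<forall>i\<in>{1..r}. A i (-1) = a i) \<and>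
     (\<forall>i\<in>{1..r}. \<forall>j\<in>{1..r}.
        A (i - 1) (- int j) * A (i + 1) (- int j)
          + A i (- int j - 1) * A i (- int j + 1) = 0)"

text \<open>For nonzero parameters these relations do define an array, uniquely on its index range.\<close>

fun a_sol :: "nat \<Rightarrow> (nat \<Rightarrow> 'k::field) \<Rightarrow> nat \<Rightarrow> nat \<Rightarrow> 'k" where
  "a_sol r a 0 i = 1"
| "a_sol r a (Suc 0) i = (if i \<in> {1..r} then a i else 1)"
| "a_sol r a (Suc (Suc j)) i =
     (if i \<in> {1..r} then - (a_sol r a (Suc j) (i - 1) * a_sol r a (Suc j) (i + 1)) / a_sol r a j i
      else 1)"

lemma a_sol_nonzero:
  assumes "\<forall>i\<in>{1..r}. a i \<noteq> 0"
  shows "a_sol r a j i \<noteq> 0"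
  using assms by (induction r a j i rule: a_sol.induct) auto

lemma a_sol_border: "i \<notin> {1..r} \<Longrightarrow> a_sol r a j i = 1"
  by (cases "(r, a, j, i)" rule: a_sol.cases) auto

lemma a_array_exists:
  assumes "\<forall>i\<in>{1..r}. a i \<noteq> 0"
  shows "a_array r a (\<lambda>i k. a_sol r a (nat (- k)) i)"
proof -
  have "a_sol r a j (i - 1) * a_sol r a j (i + 1)
      + a_sol r a (nat (1 + int j)) i * a_sol r a (nat (int j - 1)) i = 0"
    if ij: "i \<in> {1..r}" "j \<in> {1..r}" for i j
  proof -
    obtain m where m: "j = Suc m" using ij(2) by (cases j) simp_all
    have "nat (1 + int j) = Suc (Suc m)" "nat (int j - 1) = m" using m by auto
    then show ?thesis using ij m a_sol_nonzero[OF assms, of m i] by simp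
  qed
  then show ?thesis by (simp add: a_array_def a_sol_border)
qed

lemma a_array_unique:
  assumes nz: "\<forall>i\<in>{1..r}. a i \<noteq> 0" and A: "a_array r a A"
  shows "i \<in> {0..r+1} \<Longrightarrow> j \<in> {0..r+1} \<Longrightarrow> A i (- int j) = a_sol r a j i"
proof (induction j arbitrary: i rule: less_induct)
  case (less j)
  show ?case
  proof (cases "i \<in> {1..r}")
    case False
    then have "i = 0 \<or> i = r + 1" using less.prems by auto
    then show ?thesis using A less.prems False by (auto simp: a_array_def a_sol_border)
  next
    case i: True
    consider "j = 0" | "j = 1" | m where "j = Suc (Suc m)"
      by (metis One_nat_def not0_implies_Suc)
    then show ?thesis
    proof cases
      case 3
      have "Suc m \<in> {1..r}" using less.prems 3 by auto
      then have rel: "A (i - 1) (- int (Suc m)) * A (i + 1) (- int (Suc m))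
          + A i (- int (Suc m) - 1) * A i (- int (Suc m) + 1) = 0"
        using A i by (simp only: a_array_def)
      have ix: "- int (Suc m) - 1 = - int j" "- int (Suc m) + 1 = - int m" using 3 by auto
      have IH: "A (i - 1) (- int (Suc m)) = a_sol r a (Suc m) (i - 1)"
        "A (i + 1) (- int (Suc m)) = a_sol r a (Suc m) (i + 1)"
        "A i (- int m) = a_sol r a m i"
        using less.prems i 3 by (auto intro!: less.IH simp del: of_nat_Suc)
      from rel have "a_sol r a (Suc m) (i - 1) * a_sol r a (Suc m) (i + 1)
          + A i (- int j) * a_sol r a m i = 0"
        unfolding ix IH .
      then have "A i (- int j) = - (a_sol r a (Suc m) (i - 1) * a_sol r a (Suc m) (i + 1)) / a_sol r a m i"
        using a_sol_nonzero[OF nz, of m i]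
        by (subst nonzero_eq_divide_eq) (simp_all only: eq_neg_iff_add_eq_0 add.commute not_False_eq_True)
      then show ?thesis using i 3 by simp
    qed (use A i in \<open>auto simp: a_array_def\<close>)
  qed
qed

definition N_mat :: "nat \<Rightarrow> (nat \<Rightarrow> int \<Rightarrow> 'k::field) \<Rightarrow> nat \<Rightarrow> int \<Rightarrow> 'k mat" where
  "N_mat r A i k =
     (if odd (int i + k) then U_mat r i (A i (k - 1)) (A i k) (A (i + 1) (k - 1))
      else V_mat r i (A (i - 1) k) (A i (k - 1)) (A i k))"

definition P_prod :: "nat \<Rightarrow> (nat \<Rightarrow> int \<Rightarrow> 'k::field) \<Rightarrow> 'k mat" where
  "P_prod r A =
     mat_prod (r + 1) (map (\<lambda>k. mat_prod (r + 1) (map (\<lambda>i. N_mat r A i k) [1..<r+1])) [- int r..0])"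

end

theory Submission
  imports Defs
begin

text \<open>
  Apply both sides to a column vector \<open>x\<close>. Row \<open>k = -j\<close> of the product on the left fixes the coordinates
  \<open>x\<^sub>p\<close> with \<open>p + j\<close> odd and replaces those with \<open>p + j\<close> even by
  \<open>f g x\<^sub>p + f x\<^bsub>p-1\<^esub> + g x\<^bsub>p+1\<^esub>\<close>, with \<open>f = a\<^bsub>p,-j-1\<^esub> / a\<^bsub>p-1,-j\<^esub>\<close> and
  \<open>g = a\<^bsub>p-1,-j-1\<^esub> / a\<^bsub>p,-j\<^esub>\<close>. This discrete wave equation factorises: \<open>x\<^bsub>p+1\<^esub> + f x\<^sub>p\<close> is, up to
  an explicit scalar, transported one step to the left per unit of time, and \<open>x\<^bsub>p-1\<^esub> + g x\<^sub>p\<close> one step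
  to the right. At a border one of the two summands vanishes, so the waves are reflected there; after
  \<open>r + 1\<close> steps the coordinates of \<open>x\<close> appear in reversed order. The combinations transported from time \<open>0\<close>
  and to time \<open>r + 1\<close> are the unipotent factors on the right-hand side.
\<close>

section \<open>Matrices as operators on vectors with coordinates counted from 1\<close>

definition vec1 :: "nat \<Rightarrow> (nat \<Rightarrow> 'k) \<Rightarrow> 'k vec" where
  "vec1 n x = vec n (\<lambda>p. x (p + 1))"

lemma vec1_cong: "(\<And>p. 1 \<le> p \<Longrightarrow> p \<le> n \<Longrightarrow> x p = y p) \<Longrightarrow> vec1 n x = vec1 n y"
  by (auto simp: vec1_def)

lemma vec1_carrier [simp]: "vec1 n x \<in> carrier_vec n"
  by (simp add: vec1_def)

lemma mat1_carrier [simp]: "mat1 n f \<in> carrier_mat n n"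
  by (simp add: mat1_def)

lemma mat1_mult_vec1:
  "mat1 n f *\<^sub>v vec1 n x = vec1 n (\<lambda>p. \<Sum>q = 1..n. f p q * (x q :: 'k :: field))"
proof (rule eq_vecI)
  fix i assume "i < dim_vec (vec1 n (\<lambda>p. \<Sum>q = 1..n. f p q * x q))"
  then have i: "i < n" by (simp add: vec1_def)
  have "(\<Sum>q = 1..n. f (Suc i) q * x q) = (\<Sum>q = 0..<n. f (Suc i) (Suc q) * x (Suc q))"
    using sum.atLeast1_atMost_eq[of "\<lambda>q. f (Suc i) q * x q" n] by (simp add: atLeast0LessThan)
  then show "(mat1 n f *\<^sub>v vec1 n x) $ i = vec1 n (\<lambda>p. \<Sum>q = 1..n. f p q * x q) $ i"
    using i by (simp add: mat1_def vec1_def scalar_prod_def)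
qed (simp add: mat1_def vec1_def)

text \<open>Only \<open>x 1\<close>, ..., \<open>x n\<close> enter \<open>vec1 n x\<close>, so it
  suffices to test on \<open>x\<close> vanishing elsewhere; these zeros become the boundary values
  of the wave equation.\<close>

lemma mat_eq_vec1I:
  fixes M N :: "'k :: field mat"
  assumes M: "M \<in> carrier_mat n n" and N: "N \<in> carrier_mat n n"
    and eq: "\<And>x. x 0 = 0 \<Longrightarrow> (\<And>p. p > n \<Longrightarrow> x p = 0) \<Longrightarrow> M *\<^sub>v vec1 n x = N *\<^sub>v vec1 n x"
  shows "M = N"
proof (rule eq_matI)
  fix i j assume "i < dim_row N" "j < dim_col N"
  then have ij: "i < n" "j < n" using N by auto
  let ?x = "\<lambda>p. if p = j + 1 then 1 else (0 :: 'k)"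
  have u: "vec1 n ?x = unit_vec n j" by (auto simp: vec1_def unit_vec_def)
  have "M *\<^sub>v vec1 n ?x = N *\<^sub>v vec1 n ?x" using ij by (intro eq) auto
  then have "(M *\<^sub>v unit_vec n j) $ i = (N *\<^sub>v unit_vec n j) $ i" by (simp only: u)
  then show "M $$ (i, j) = N $$ (i, j)" using M N ij by simp
qed (use M N in auto)

lemma U_mat_carrier [simp]: "U_mat r i a b c \<in> carrier_mat (Suc r) (Suc r)"
  by (simp add: U_mat_def)

lemma V_mat_carrier [simp]: "V_mat r i a b c \<in> carrier_mat (Suc r) (Suc r)"
  by (simp add: V_mat_def)

lemma P_mat_carrier [simp]: "P_mat r \<in> carrier_mat (Suc r) (Suc r)"
  by (simp add: P_mat_def)

lemma U_mat_mult_vec1: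
  assumes i: "1 \<le> i" "i \<le> r"
  shows "U_mat r i a b c *\<^sub>v vec1 (r + 1) x =
    vec1 (r + 1) (x(i + 1 := c / b * x i + a / b * x (i + 1)))"
  unfolding U_mat_def mat1_mult_vec1
proof (rule vec1_cong)
  fix p assume p: "1 \<le> p" "p \<le> r + 1"
  let ?f = "\<lambda>p q. if p = i + 1 \<and> q = i then c / b
     else if p = i + 1 \<and> q = i + 1 then a / b else if p = q then 1 else 0"
  show "(\<Sum>q = 1..r + 1. ?f p q * x q) = (x(i + 1 := c / b * x i + a / b * x (i + 1))) p"
  proof (cases "p = i + 1")
    case True
    have "(\<Sum>q = 1..r + 1. ?f p q * x q) =
       (\<Sum>q = 1..r + 1. (if q = i then c / b * x q else 0) + (if q = i + 1 then a / b * x q else 0))"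
      by (rule sum.cong) (auto simp: True)
    also have "\<dots> = c / b * x i + a / b * x (i + 1)"
      using i by (simp add: sum.distrib)
    finally show ?thesis using True by simp
  next
    case False
    have "(\<Sum>q = 1..r + 1. ?f p q * x q) = (\<Sum>q = 1..r + 1. if q = p then x q else 0)"
      by (rule sum.cong) (use False in auto)
    then show ?thesis using p False by simp
  qed
qed

lemma V_mat_mult_vec1:
  assumes i: "1 \<le> i" "i \<le> r"
  shows "V_mat r i a b c *\<^sub>v vec1 (r + 1) x =
    vec1 (r + 1) (x(i := b / c * x i + a / c * x (i + 1)))"
  unfolding V_mat_def mat1_mult_vec1
proof (rule vec1_cong)
  fix p assume p: "1 \<le> p" "p \<le> r + 1"
  let ?f = "\<lambda>p q. if p = i \<and> q = i then b / c
     else if p = i \<and> q = i + 1 then a / c else if p = q then 1 else 0"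
  show "(\<Sum>q = 1..r + 1. ?f p q * x q) = (x(i := b / c * x i + a / c * x (i + 1))) p"
  proof (cases "p = i")
    case True
    have "(\<Sum>q = 1..r + 1. ?f p q * x q) =
       (\<Sum>q = 1..r + 1. (if q = i then b / c * x q else 0) + (if q = i + 1 then a / c * x q else 0))"
      by (rule sum.cong) (auto simp: True)
    also have "\<dots> = b / c * x i + a / c * x (i + 1)"
      using i by (simp add: sum.distrib)
    finally show ?thesis using True by simp
  next
    case False
    have "(\<Sum>q = 1..r + 1. ?f p q * x q) = (\<Sum>q = 1..r + 1. if q = p then x q else 0)"
      by (rule sum.cong) (use False in auto)
    then show ?thesis using p False by simp
  qed
qed

lemma P_mat_mult_vec1:
  "P_mat r *\<^sub>v vec1 (r + 1) x =
    vec1 (r + 1) (\<lambda>p. (-1) ^ ((r - 1) * (p - 1)) * x (r + 2 - p))"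
  unfolding P_mat_def mat1_mult_vec1
proof (rule vec1_cong)
  fix p assume p: "1 \<le> p" "p \<le> r + 1"
  have "(\<Sum>q = 1..r + 1. (if p + q = r + 2 then (-1) ^ ((r - 1) * (p - 1)) else 0) * x q) =
     (\<Sum>q = 1..r + 1. if q = r + 2 - p then (-1) ^ ((r - 1) * (p - 1)) * x q else 0)"
    by (rule sum.cong) (use p in auto)
  then show "(\<Sum>q = 1..r + 1. (if p + q = r + 2 then (-1) ^ ((r - 1) * (p - 1)) else 0) * x q) =
     (-1) ^ ((r - 1) * (p - 1)) * x (r + 2 - p)"
    using p by (auto simp del: sum.cl_ivl_Suc)
qed

lemma mat_prod_carrier:
  assumes "set Ms \<subseteq> carrier_mat n n"
  shows "mat_prod n Ms \<in> carrier_mat n n"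
  using assms by (induction Ms) (auto simp: mat_prod_def intro!: mult_carrier_mat)

lemma mat_prod_Nil_mult_vec: "mat_prod n [] *\<^sub>v vec1 n x = vec1 n x"
  by (simp add: mat_prod_def)

lemma mat_prod_Cons_mult_vec:
  assumes "set (M # Ms) \<subseteq> carrier_mat n n" "v \<in> carrier_vec n"
  shows "mat_prod n (M # Ms) *\<^sub>v v = M *\<^sub>v (mat_prod n Ms *\<^sub>v v)"
proof -
  have "mat_prod n (M # Ms) = M * mat_prod n Ms" by (simp add: mat_prod_def)
  then show ?thesis using assms mat_prod_carrier[of Ms n] assoc_mult_mat_vec[of M n n "mat_prod n Ms" n v] by auto
qed

text \<open>Factor \<open>i\<close> only adds a multiple of coordinate \<open>i\<close> to
  coordinate \<open>i + 1\<close>. Equal parity excludes adjacent indices, so neither factor changes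
  a coordinate that the other one adds.\<close>

lemma U_mat_commute:
  assumes ij: "1 \<le> i" "i \<le> r" "1 \<le> j" "j \<le> r" and ev: "even (i + j)"
  shows "U_mat r i 1 1 c * U_mat r j 1 1 d = U_mat r j 1 1 d * U_mat r i 1 1 (c :: 'k :: field)"
    (is "?M * ?N = _")
proof (cases "i = j")
  case True
  show ?thesis
  proof (rule mat_eq_vec1I[of _ "r + 1"])
    fix x :: "nat \<Rightarrow> 'k"
    show "(?M * ?N) *\<^sub>v vec1 (r + 1) x = (?N * ?M) *\<^sub>v vec1 (r + 1) x"
      using ij unfolding True
      by (subst (1 2) assoc_mult_mat_vec[of _ "r + 1" "r + 1" _ "r + 1"])
        (auto simp: U_mat_mult_vec1[simplified] intro!: vec1_cong)
  qed (auto intro!: mult_carrier_mat[of _ _ "r + 1"])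
next
  case False
  have "i \<noteq> j + 1" "j \<noteq> i + 1" using ev by auto
  show ?thesis
  proof (rule mat_eq_vec1I[of _ "r + 1"])
    fix x :: "nat \<Rightarrow> 'k"
    show "(?M * ?N) *\<^sub>v vec1 (r + 1) x = (?N * ?M) *\<^sub>v vec1 (r + 1) x"
      using ij False \<open>i \<noteq> j + 1\<close> \<open>j \<noteq> i + 1\<close>
      by (subst (1 2) assoc_mult_mat_vec[of _ "r + 1" "r + 1" _ "r + 1"])
        (auto simp: U_mat_mult_vec1[simplified] intro!: vec1_cong)
  qed (auto intro!: mult_carrier_mat[of _ _ "r + 1"])
qed

text \<open>Because all positions \<open>h i\<close> have the same parity, every factor adds an
  original coordinate, and the product is a simultaneous update. Coefficients are indexed by
  position so that the result depends on the row \<open>p\<close> alone.\<close>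

lemma mat_prod_U_mat_mult_vec1:
  fixes c :: "nat \<Rightarrow> 'k :: field"
  assumes "\<And>i. i \<in> set is \<Longrightarrow> 1 \<le> h i \<and> h i \<le> r" "\<And>i j. i \<in> set is \<Longrightarrow> j \<in> set is \<Longrightarrow> even (h i + h j)"
    "distinct (map h is)"
  shows "mat_prod (r + 1) (map (\<lambda>i. U_mat r (h i) 1 1 (c (h i))) is) *\<^sub>v vec1 (r + 1) x =
    vec1 (r + 1) (\<lambda>p. if p - 1 \<in> h ` set is then x p + c (p - 1) * x (p - 1) else x p)"
  using assms
proof (induction "is")
  case Nil
  then show ?case by (simp add: mat_prod_Nil_mult_vec)
next
  case (Cons i js)
  let ?y = "\<lambda>p. if p - 1 \<in> h ` set js then x p + c (p - 1) * x (p - 1) else x p"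
  have i: "1 \<le> h i" "h i \<le> r" using Cons.prems(1)[of i] by auto
  have a: "h i - 1 \<notin> h ` set js"
  proof
    assume "h i - 1 \<in> h ` set js"
    then obtain j where j: "j \<in> set js" "h i - 1 = h j" by auto
    then show False using Cons.prems(2)[of i j] i by (simp, presburger)
  qed
  have b: "h i \<notin> h ` set js" using Cons.prems(3) by auto
  have "mat_prod (r + 1) (map (\<lambda>i. U_mat r (h i) 1 1 (c (h i))) (i # js)) *\<^sub>v vec1 (r + 1) x
      = U_mat r (h i) 1 1 (c (h i)) *\<^sub>v (mat_prod (r + 1) (map (\<lambda>i. U_mat r (h i) 1 1 (c (h i))) js) *\<^sub>v vec1 (r + 1) x)"
    unfolding list.map by (rule mat_prod_Cons_mult_vec) (auto)
  also have "\<dots> = U_mat r (h i) 1 1 (c (h i)) *\<^sub>v vec1 (r + 1) ?y"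
    using Cons by (subst Cons.IH) auto
  also have "\<dots> = vec1 (r + 1) (?y(h i + 1 := c (h i) / 1 * ?y (h i) + 1 / 1 * ?y (h i + 1)))"
    by (rule U_mat_mult_vec1[OF i])
  also have "\<dots> = vec1 (r + 1) (\<lambda>p. if p - 1 \<in> h ` set (i # js) then x p + c (p - 1) * x (p - 1) else x p)"
    using a b by (intro vec1_cong) auto
  finally show ?case .
qed


section \<open>The T-system with signs and the discrete wave equation it governs\<close>

locale sign_T_system =
  fixes r :: nat and a :: "nat \<Rightarrow> 'k :: field" and x :: "nat \<Rightarrow> 'k"
  assumes nz: "\<forall>i\<in>{1..r}. a i \<noteq> 0"
    and x_0: "x 0 = 0" and x_out: "p > r + 1 \<Longrightarrow> x p = 0"
begin

text \<open>The time \<open>j\<close> is the negated second index of the array. With the explicit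
  solution in place of \<open>A\<close>, border values and bilinear relation hold at all times, not
  only up to \<open>r + 1\<close>.\<close>

definition b :: "nat \<Rightarrow> nat \<Rightarrow> 'k" where "b i j = a_sol r a j i"

text \<open>By the bilinear relation, \<open>f\<close> is constant up to sign along the lines where \<open>p + j\<close> is constant, and
  \<open>g\<close> along those where \<open>p - j\<close> is; this is what makes \<open>zl\<close> and \<open>zr\<close> below travel without dispersion.\<close>

definition f :: "nat \<Rightarrow> nat \<Rightarrow> 'k" where "f p j = b p (Suc j) / b (p - 1) j"

definition g :: "nat \<Rightarrow> nat \<Rightarrow> 'k" where "g p j = b (p - 1) (Suc j) / b p j"

text \<open>\<open>state j\<close> is the vector obtained from \<open>x\<close> by applying the rows \<open>k = 0, -1, \<dots>, 1 - j\<close>.\<close>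

fun state :: "nat \<Rightarrow> nat \<Rightarrow> 'k" where
  "state 0 p = x p"
| "state (Suc j) p =
    (if 1 \<le> p \<and> p \<le> r + 1 \<and> even (p + j)
     then f p j * g p j * state j p + f p j * state j (p - 1) + g p j * state j (p + 1)
     else state j p)"

lemmas state_Suc = state.simps(2)
declare state_Suc [simp del]

lemma b_nonzero [simp]: "b i j \<noteq> 0"
  unfolding b_def by (rule a_sol_nonzero[OF nz])

lemma b_left [simp]: "b 0 j = 1"
  and b_right [simp]: "b (Suc r) j = 1"
  and b_zero [simp]: "b i 0 = 1"
  by (auto simp: b_def a_sol_border)

lemma b_one: "1 \<le> i \<Longrightarrow> i \<le> r \<Longrightarrow> b i (Suc 0) = a i"
  by (simp add: b_def)

lemma b_rec: "1 \<le> i \<Longrightarrow> i \<le> r \<Longrightarrow> b i (Suc (Suc j)) * b i j = - (b (i - 1) (Suc j) * b (i + 1) (Suc j))"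
  using b_nonzero[of i j] by (simp add: b_def)

lemma f_shift:
  assumes "1 \<le> p" "p \<le> r"
  shows "f p (Suc j) = - f (p + 1) j"
  using b_rec[OF assms, of j] unfolding f_def by (simp add: divide_simps)

lemma g_shift:
  assumes "1 \<le> p" "p \<le> r"
  shows "g (p + 1) (Suc j) = - g p j"
  using b_rec[OF assms, of j] unfolding g_def by (simp add: divide_simps)

lemma f_shift_iter: "1 \<le> p \<Longrightarrow> p + m \<le> r + 1 \<Longrightarrow> f p (j + m) = (-1) ^ m * f (p + m) j"
proof (induction m arbitrary: j)
  case (Suc m)
  have "f p (j + Suc m) = f p (Suc j + m)" by simp
  also have "\<dots> = (-1) ^ m * f (p + m) (Suc j)" using Suc.prems by (intro Suc.IH) auto
  finally show ?case using f_shift[of "p + m" j] Suc.prems by simp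
qed simp

lemma g_shift_iter: "1 \<le> p \<Longrightarrow> p + m \<le> r + 1 \<Longrightarrow> g (p + m) (j + m) = (-1) ^ m * g p j"
proof (induction m)
  case (Suc m)
  have "g (p + Suc m) (j + Suc m) = - g (p + m) (j + m)"
    using g_shift[of "p + m" "j + m"] Suc.prems by simp
  then show ?case using Suc by simp
qed simp

text \<open>With the border value 1 as denominator, \<open>f 1 (j - 1)\<close> is
  \<open>b 1 j\<close>, and its line meets time 0 in \<open>f j 0 = a j\<close>. \<open>b_r\<close>
  is the mirror image, with \<open>g\<close>.\<close>

lemma b_1: "1 \<le> j \<Longrightarrow> j \<le> r \<Longrightarrow> b 1 j = (-1) ^ (j - 1) * a j"
  using f_shift_iter[of 1 "j - 1" 0] by (simp add: f_def b_one)

lemma b_1_last: "b 1 (r + 1) = (-1) ^ r"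
  using f_shift_iter[of 1 r 0] by (simp add: f_def)

lemma b_r: "1 \<le> j \<Longrightarrow> j \<le> r \<Longrightarrow> b r j = (-1) ^ (j - 1) * a (r + 1 - j)"
  using g_shift_iter[of "r + 2 - j" "j - 1" 0] by (simp add: g_def b_one Suc_diff_le)

text \<open>Followed back in time, the line reaches column \<open>r + 1\<close>, where the numerator
  of \<open>f\<close> is a border value and \<open>f\<close> is the reciprocal of
  \<open>b r p\<close>.\<close>

lemma f_last: "1 \<le> p \<Longrightarrow> p \<le> r \<Longrightarrow> f p (r + 1) = (-1) ^ r / a (r + 1 - p)"
proof -
  assume p: "1 \<le> p" "p \<le> r"
  have "f p (r + 1) = (-1) ^ (r + 1 - p) * f (r + 1) p"
    using f_shift_iter[of p "r + 1 - p" p] p by simp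
  also have "\<dots> = (-1) ^ (r + 1 - p) / ((-1) ^ (p - 1) * a (r + 1 - p))"
    using b_r[OF p] by (simp add: f_def)
  also have "\<dots> = (-1) ^ (r + 1 - p) * (-1) ^ (p - 1) / a (r + 1 - p)"
    by (simp add: minus_one_power_iff)
  also have "\<dots> = (-1) ^ r / a (r + 1 - p)"
    using p by (simp flip: power_add)
  finally show ?thesis .
qed

lemma g_last: "2 \<le> p \<Longrightarrow> p \<le> r + 1 \<Longrightarrow> g p (r + 1) = (-1) ^ r / a (r + 2 - p)"
proof -
  assume p: "2 \<le> p" "p \<le> r + 1"
  let ?n = "r + 2 - p"
  have n: "1 \<le> ?n" "?n \<le> r" using p by auto
  have "g p (r + 1) = (-1) ^ (p - 1) * g 1 ?n"
    using g_shift_iter[of 1 "p - 1" ?n] p by simp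
  also have "\<dots> = (-1) ^ (p - 1) / ((-1) ^ (?n - 1) * a ?n)"
    using b_1[OF n] by (simp add: g_def)
  also have "\<dots> = (-1) ^ (p - 1) * (-1) ^ (?n - 1) / a ?n"
    by (simp add: minus_one_power_iff)
  also have "\<dots> = (-1) ^ r / a ?n"
    using p by (simp flip: power_add)
  finally show ?thesis .
qed

text \<open>Half-periodicity of the T-system: at time \<open>r + 1\<close> all values are signs
  again. There \<open>f\<close> and \<open>g\<close> agree at neighbouring positions; shifted back
  to time \<open>r\<close>, this equates two quotients with the same denominator
  \<open>b (q + 1) r\<close>, which gives period 2 in \<open>p\<close>.\<close>

lemma b_last: "p \<le> r + 1 \<Longrightarrow> b p (r + 1) = (-1) ^ (r * p)"
proof (induction p rule: less_induct)
  case (less p)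
  consider "p = 0" | "p = 1" | q where "p = Suc (Suc q)"
    by (metis One_nat_def not0_implies_Suc)
  then show ?case
  proof cases
    case 3
    have q: "q + 1 \<le> r" using less.prems 3 by simp
    have "f (q + 2) r = - f (q + 1) (r + 1)" "g (q + 1) r = - g (q + 2) (r + 1)"
      using f_shift[of "q + 1" r] g_shift[of "q + 1" r] q by simp_all
    moreover have "f (q + 1) (r + 1) = g (q + 2) (r + 1)"
      using f_last[of "q + 1"] g_last[of "q + 2"] q by simp
    ultimately have "f (q + 2) r = g (q + 1) r" by simp
    then have "b p (r + 1) = b q (r + 1)"
      by (simp add: f_def g_def 3 divide_simps)
    then show ?thesis using less 3 by (simp add: power_add)
  qed (use b_1_last in auto)
qed

section \<open>Left- and right-moving waves\<close>

lemma state_0 [simp]: "state j 0 = 0"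
  by (induction j) (auto simp: x_0 state_Suc)

lemma state_out [simp]: "state j (Suc (Suc r)) = 0"
  by (induction j) (auto simp: x_out state_Suc)

text \<open>The characteristic variables of the wave equation. At \<open>p = 0\<close> truncated
  subtraction makes \<open>f 0 j\<close> equal to 1, which is harmless since it multiplies
  \<open>state j 0 = 0\<close>.\<close>

definition zl :: "nat \<Rightarrow> nat \<Rightarrow> 'k" where "zl j p = state j (p + 1) + f p j * state j p"

definition zr :: "nat \<Rightarrow> nat \<Rightarrow> 'k" where "zr j p = state j (p - 1) + g p j * state j p"

text \<open>In this step \<open>p\<close> rests and \<open>p + 1\<close> is updated. The sign in
  \<open>f_shift\<close> cancels the term in \<open>state j p\<close>, and
  \<open>g (p + 1) j\<close> factors out of the rest. \<open>zr_step\<close> is the mirror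
  image.\<close>

lemma zl_step:
  assumes "p \<le> r" "even (p + Suc j)"
  shows "zl (Suc j) p = g (p + 1) j * zl j (p + 1)"
proof -
  \<comment> \<open>At \<open>p = 0\<close> no shift relation is available, but both sides
    vanish.\<close>
  have *: "f p (Suc j) * state j p = - f (p + 1) j * state j p"
    using f_shift[of p j] assms(1) by (cases "p = 0") auto
  have "zl (Suc j) p = state (Suc j) (p + 1) + f p (Suc j) * state j p"
    using assms by (simp add: zl_def state_Suc)
  also have "\<dots> = g (p + 1) j * zl j (p + 1)"
    using assms unfolding * by (simp add: zl_def state_Suc algebra_simps)
  finally show ?thesis .
qed

lemma zr_step:
  assumes "1 \<le> p" "p \<le> r + 1" "even (p + j)"
  shows "zr (Suc j) (p + 1) = f p j * zr j p"
proof -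
  have *: "g (p + 1) (Suc j) * state j (p + 1) = - g p j * state j (p + 1)"
    using g_shift[of p j] assms by (cases "p = r + 1") auto
  have "zr (Suc j) (p + 1) = state (Suc j) p + g (p + 1) (Suc j) * state j (p + 1)"
    using assms by (simp add: zr_def state_Suc)
  also have "\<dots> = f p j * zr j p"
    using assms unfolding * by (simp add: zr_def state_Suc algebra_simps)
  finally show ?thesis .
qed

text \<open>The factors \<open>g\<close> met along the line telescope: the denominator of each is
  the numerator of the next.\<close>

lemma zl_transport:
  "p + m \<le> r + 1 \<Longrightarrow> even (p + m + j) \<Longrightarrow>
    zl (j + m) p = b p (j + m) / b (p + m) j * zl j (p + m)"
proof (induction m arbitrary: p)
  case (Suc m)
  have "zl (j + Suc m) p = g (p + 1) (j + m) * zl (j + m) (p + 1)"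
    using zl_step[of p "j + m"] Suc.prems by (simp add: ac_simps)
  also have "zl (j + m) (p + 1) = b (p + 1) (j + m) / b (p + 1 + m) j * zl j (p + 1 + m)"
    using Suc.prems by (intro Suc.IH) auto
  finally show ?case by (simp add: g_def)
qed simp

lemma zr_transport:
  "1 \<le> p \<Longrightarrow> p + m \<le> r + 2 \<Longrightarrow> even (p + j) \<Longrightarrow>
    zr (j + m) (p + m) = b (p + m - 1) (j + m) / b (p - 1) j * zr j p"
proof (induction m)
  case (Suc m)
  have "zr (j + Suc m) (p + Suc m) = f (p + m) (j + m) * zr (j + m) (p + m)"
    using zr_step[of "p + m" "j + m"] Suc.prems by simp
  also have "zr (j + m) (p + m) = b (p + m - 1) (j + m) / b (p - 1) j * zr j p"
    using Suc by simp
  finally show ?case by (simp add: f_def)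
qed simp

section \<open>Reflection at the borders and the state at time \<open>r + 1\<close>\<close>

lemma state_left:
  assumes "even j" "j \<le> r"
  shows "state j 1 = x (j + 1) + a j * x j"
proof -
  \<comment> \<open>As \<open>state j 0 = 0\<close>, the border value is a left-moving wave, which
    is traced back to time 0 with transport scalar 1.\<close>
  have "state j 1 = zl j 0" by (simp add: zl_def)
  also have "\<dots> = zl 0 j" using zl_transport[of 0 j 0] assms by simp
  also have "\<dots> = x (j + 1) + a j * x j"
    using assms by (cases "j = 0") (simp_all add: zl_def x_0 f_def b_one)
  finally show ?thesis .
qed

text \<open>Coordinate \<open>r + 1\<close> rests in the step from time \<open>j - 1\<close> to
  \<open>j\<close>, and at time \<open>j - 1\<close> it is the right-moving wave at position
  \<open>r + 2\<close>, which started at time 0. \<open>b\<close> stands in place of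
  \<open>a\<close> because \<open>j = 1\<close> refers to the border index
  \<open>r + 1\<close>.\<close>

lemma state_right:
  assumes "even (r + 1 + j)" "1 \<le> j" "j \<le> r + 1"
  shows "state j (r + 1) = x (r + 2 - j) + b (r + 2 - j) 1 * x (r + 3 - j)"
proof -
  obtain i where i: "j = Suc i" using assms by (cases j) auto
  have "state j (r + 1) = state i (r + 1)"
    using assms i by (simp add: state_Suc)
  also have "\<dots> = zr i (r + 2)" by (simp add: zr_def)
  also have "\<dots> = zr 0 (r + 2 - i)"
    using zr_transport[of "r + 2 - i" i 0] assms i by simp
  also have "\<dots> = x (r + 2 - j) + b (r + 2 - j) 1 * x (r + 3 - j)"
    using assms i by (simp add: zr_def g_def Suc_diff_le)
  finally show ?thesis .
qed

text \<open>For \<open>p > 1\<close>, the right-moving wave through \<open>p\<close> at time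
  \<open>r + 1\<close> left the left border at time \<open>n\<close>, as the reflection of the wave
  evaluated in \<open>state_left\<close>. The neighbour \<open>state (r + 1) (p - 1)\<close> is kept
  on purpose: in this form the relation is the action of a left unipotent factor on the reversed
  vector.\<close>

lemma final_state_fixed_parity:
  assumes p: "1 \<le> p" "p \<le> r + 1" "odd (p + r)" and n: "n = r + 2 - p"
  shows "state (r + 1) p =
    (-1) ^ (r * p) * (x n + a (n - 1) * x (n - 1)) + (-1) ^ (r + 1) * a n * state (r + 1) (p - 1)"
proof -
  have n': "odd n" "1 \<le> n" "n \<le> r + 1" using p n by auto
  \<comment> \<open>Since \<open>n\<close> is odd, coordinate 1 rests in the step from time
    \<open>n - 1\<close> to \<open>n\<close>.\<close>
  have "state n 1 = state (n - 1) 1"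
    using n' by (cases n) (auto simp: state_Suc)
  also have "\<dots> = x n + a (n - 1) * x (n - 1)"
    using state_left[of "n - 1"] n' by simp
  finally have y: "state n 1 = x n + a (n - 1) * x (n - 1)" .
  show ?thesis
  proof (cases "p = 1")
    case True
    then show ?thesis using y n n'(1) by simp
  next
    case False
    then have p2: "2 \<le> p" and nr: "n \<le> r" using p n by auto
    have an: "a n \<noteq> 0" using nz nr n' by auto
    have "state (r + 1) (p - 1) + (-1) ^ r / a n * state (r + 1) p = zr (r + 1) p"
      unfolding zr_def g_last[OF p2 p(2)] n ..
    also have "\<dots> = b (p - 1) (r + 1) * zr n 1"
      using zr_transport[of 1 "p - 1" n] p2 p n n' by simp
    also have "\<dots> = (-1) ^ (r * (p - 1)) * ((x n + a (n - 1) * x (n - 1)) / a n)"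
      using b_last[of "p - 1"] b_1[of n] p n' nr y by (simp add: zr_def g_def)
    finally have zr: "state (r + 1) (p - 1) + (-1) ^ r / a n * state (r + 1) p
        = (-1) ^ (r * (p - 1)) * ((x n + a (n - 1) * x (n - 1)) / a n)" .
    have \<epsilon>: "(-1 :: 'k) ^ r * (-1) ^ r = 1" by (simp flip: power_add)
    have "state (r + 1) p = (-1) ^ r * (-1) ^ r * state (r + 1) p" by (simp only: \<epsilon> mult_1)
    also have "\<dots> = (-1) ^ r * a n * (state (r + 1) (p - 1) + (-1) ^ r / a n * state (r + 1) p)
        + (-1) ^ (r + 1) * a n * state (r + 1) (p - 1)"
      using an by (simp add: distrib_left)
    also have "\<dots> = (-1) ^ r * (-1) ^ (r * (p - 1)) * (x n + a (n - 1) * x (n - 1))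
        + (-1) ^ (r + 1) * a n * state (r + 1) (p - 1)"
      unfolding zr using an by simp
    also have "(-1 :: 'k) ^ r * (-1) ^ (r * (p - 1)) = (-1) ^ (r * p)"
      using p by (cases p) (simp_all add: power_add)
    finally show ?thesis .
  qed
qed

text \<open>For \<open>p > 1\<close>, the left-moving wave through \<open>t = p - 1\<close> at time
  \<open>r + 1\<close> left the right border at time \<open>t\<close>, where
  \<open>state_right\<close> evaluates it. The value at \<open>t\<close> is known from
  \<open>final_state_fixed_parity\<close> and the induction hypothesis at \<open>p - 2\<close>;
  subtracting its multiple cancels \<open>x n\<close> and \<open>x (n + 1)\<close> and leaves only
  \<open>x (n - 1)\<close>.\<close>

lemma final_state_moved_parity:
  "p \<le> r + 1 \<Longrightarrow> even (p + r) \<Longrightarrow> state (r + 1) p = - ((-1) ^ (r * p)) * x (r + 2 - p)"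
proof (induction p rule: less_induct)
  case (less p)
  consider "p = 0" | "p = 1" | q where "p = Suc (Suc q)"
    by (metis One_nat_def not0_implies_Suc)
  then show ?case
  proof cases
    case 1
    then show ?thesis by (simp add: x_out)
  next
    case 2
    have "state (r + 1) 1 = zl (r + 1) 0" by (simp add: zl_def)
    also have "\<dots> = x (r + 1)"
      using zl_transport[of 0 "r + 1" 0] 2 less.prems by (simp add: zl_def f_def x_out)
    finally show ?thesis using 2 less.prems by simp
  next
    case 3
    define t where "t = q + 1"
    define n where "n = r + 2 - t"
    define c \<epsilon> :: 'k where "c = (-1) ^ (r * t)" and "\<epsilon> = (-1) ^ r"
    have \<epsilon>: "\<epsilon> * \<epsilon> = 1" unfolding \<epsilon>_def by (simp flip: power_add)
    have t: "1 \<le> t" "t \<le> r" "odd (t + r)" and n: "2 \<le> n" "n \<le> r + 1"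
      using 3 less.prems by (auto simp: t_def n_def)
    have \<alpha>: "a (n - 1) \<noteq> 0" using n by (intro nz[rule_format]) auto
    have sq: "(-1 :: 'k) ^ (r * q) = c * \<epsilon>" and sp: "(-1 :: 'k) ^ (r * p) = c * \<epsilon>"
      using \<epsilon> by (simp_all add: c_def \<epsilon>_def t_def 3 power_add mult.assoc)
    have "state (r + 1) q = - (c * \<epsilon>) * x (n + 1)"
      using less.IH[of q] less.prems 3 sq by (simp add: n_def t_def Suc_diff_le)
    then have st: "state (r + 1) t = c * (x n + a (n - 1) * x (n - 1) + a n * x (n + 1))"
      using final_state_fixed_parity[of t n] t \<epsilon>
      by (simp add: n_def flip: c_def \<epsilon>_def) (simp add: t_def algebra_simps)
    \<comment> \<open>For \<open>n = r + 1\<close> the value \<open>a n\<close> is arbitrary, but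
      \<open>x (r + 2) = 0\<close>.\<close>
    have bn: "b n 1 * x (n + 1) = a n * x (n + 1)"
      using n by (cases "n = r + 1") (simp_all add: x_out b_one)
    have "(-1 :: 'k) ^ (t - 1) = \<epsilon>"
      unfolding \<epsilon>_def using t by (auto simp: minus_one_power_iff)
    then have br: "b r t = \<epsilon> * a (n - 1)"
      using b_r[OF t(1,2)] t by (simp add: n_def Suc_diff_le)
    have "state (r + 1) p + \<epsilon> / a (n - 1) * state (r + 1) t = zl (r + 1) t"
      unfolding zl_def f_last[OF t(1,2)] using t by (simp add: t_def 3 n_def \<epsilon>_def)
    also have "\<dots> = c * (f (r + 1) t * state t (r + 1))"
      using zl_transport[of t "r + 1 - t" t] b_last[of t] t by (simp add: zl_def c_def)
    also have "f (r + 1) t = \<epsilon> / a (n - 1)"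
      using br \<alpha> \<epsilon> by (simp add: f_def divide_simps)
    also have "state t (r + 1) = x n + a n * x (n + 1)"
      using state_right[of t] t bn by (simp add: n_def Suc_diff_le numeral_3_eq_3)
    finally have "state (r + 1) p =
        c * (\<epsilon> / a (n - 1) * (x n + a n * x (n + 1))) - \<epsilon> / a (n - 1) * state (r + 1) t"
      by (simp add: eq_diff_eq)
    also have "\<dots> = - (c * \<epsilon>) * x (n - 1)"
      unfolding st using \<alpha> by (simp add: field_simps)
    finally have "state (r + 1) p = - (c * \<epsilon>) * x (n - 1)" .
    then show ?thesis using sp 3 by (simp add: n_def t_def)
  qed
qed

section \<open>One row of the matrix product as one time step\<close>

definition factor :: "nat \<Rightarrow> nat \<Rightarrow> 'k mat" where
  "factor j i =
     (if odd (i + j) then U_mat r i (b i (Suc j)) (b i j) (b (i + 1) (Suc j))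
      else V_mat r i (b (i - 1) j) (b i (Suc j)) (b i j))"

lemma factor_carrier [simp]: "factor j i \<in> carrier_mat (Suc r) (Suc r)"
  by (simp add: factor_def)

text \<open>The rightmost factor acts first, so \<open>i\<close> descends. A coordinate
  \<open>p\<close> with \<open>p + j\<close> even is in general changed twice, by the
  \<open>V_mat\<close> of index \<open>p\<close> and then by the \<open>U_mat\<close> of index
  \<open>p - 1\<close>; the middle case is its value between the two changes.\<close>

lemma partial_row_mult_state:
  assumes "1 \<le> i" "i \<le> r + 1"
  shows "mat_prod (r + 1) (map (factor j) [i..<r + 1]) *\<^sub>v vec1 (r + 1) (state j) =
    vec1 (r + 1) (\<lambda>p. if p < i \<or> odd (p + j) then state j p
       else if p = i then b i (Suc j) / b i j * state j i + b (i - 1) j / b i j * state j (i + 1)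
       else state (Suc j) p)"
  using assms(2,1)
proof (induction i rule: inc_induct)
  \<comment> \<open>No factor has index \<open>r + 1\<close>, but the half-updated form there equals
    the old value, by the border value 1 and the zero at \<open>r + 2\<close>.\<close>
  case base
  show ?case by (auto simp: mat_prod_Nil_mult_vec[simplified] intro!: vec1_cong)
next
  case (step i)
  let ?S = "\<lambda>i p. if p < i \<or> odd (p + j) then state j p
       else if p = i then b i (Suc j) / b i j * state j i + b (i - 1) j / b i j * state j (i + 1)
       else state (Suc j) p"
  have i: "1 \<le> i" "i \<le> r" using step by auto
  have "mat_prod (r + 1) (map (factor j) [i..<r + 1]) *\<^sub>v vec1 (r + 1) (state j)
     = mat_prod (r + 1) (factor j i # map (factor j) [Suc i..<r + 1]) *\<^sub>v vec1 (r + 1) (state j)"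
    using i by (simp add: upt_conv_Cons del: upt_Suc)
  also have "\<dots> = factor j i *\<^sub>v (mat_prod (r + 1) (map (factor j) [Suc i..<r + 1]) *\<^sub>v vec1 (r + 1) (state j))"
    by (rule mat_prod_Cons_mult_vec) auto
  also have "\<dots> = factor j i *\<^sub>v vec1 (r + 1) (?S (Suc i))"
    using step.IH by simp
  also have "\<dots> = vec1 (r + 1) (?S i)"
  proof (cases "odd (i + j)")
    case True
    have "factor j i *\<^sub>v vec1 (r + 1) (?S (Suc i)) = vec1 (r + 1) ((?S (Suc i))
        (i + 1 := b (i + 1) (Suc j) / b i j * ?S (Suc i) i + b i (Suc j) / b i j * ?S (Suc i) (i + 1)))"
      unfolding factor_def if_P[OF True] by (rule U_mat_mult_vec1[OF i])
    also have "\<dots> = vec1 (r + 1) (?S i)"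
    proof (rule vec1_cong)
      fix p assume "1 \<le> p" "p \<le> r + 1"
      then show "((?S (Suc i))
        (i + 1 := b (i + 1) (Suc j) / b i j * ?S (Suc i) i + b i (Suc j) / b i j * ?S (Suc i) (i + 1))) p = ?S i p"
        using True i by (cases "p = i + 1") (auto simp: f_def g_def state_Suc field_simps)
    qed
    finally show ?thesis .
  next
    case False
    have "factor j i *\<^sub>v vec1 (r + 1) (?S (Suc i)) = vec1 (r + 1) ((?S (Suc i))
        (i := b i (Suc j) / b i j * ?S (Suc i) i + b (i - 1) j / b i j * ?S (Suc i) (i + 1)))"
      unfolding factor_def if_not_P[OF False] by (rule V_mat_mult_vec1[OF i])
    also have "\<dots> = vec1 (r + 1) (?S i)"
      using False i by (intro vec1_cong) auto
    finally show ?thesis .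
  qed
  finally show ?case .
qed

text \<open>No factor of index 0 completes coordinate 1; since \<open>b 0 j = 1\<close> and
  \<open>state j 0 = 0\<close>, its half-updated form is already the full update.\<close>

lemma row_mult_state:
  "mat_prod (r + 1) (map (factor j) [1..<r + 1]) *\<^sub>v vec1 (r + 1) (state j) =
    vec1 (r + 1) (state (Suc j))"
  by (subst partial_row_mult_state) (auto intro!: vec1_cong simp: f_def g_def state_Suc)

lemma N_mat_eq_factor:
  assumes A: "a_array r a A" and "1 \<le> i" "i \<le> r" "j \<le> r"
  shows "N_mat r A i (- int j) = factor j i"
proof -
  have A_eq: "A k (- int l) = b k l" if "k \<le> r + 1" "l \<le> r + 1" for k l
    using a_array_unique[OF nz A] that by (simp add: b_def)
  have A_eq': "A k (- int j - 1) = b k (Suc j)" if "k \<le> r + 1" for k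
    using A_eq[of k "Suc j"] that assms(4) by (simp add: minus_diff_commute)
  have "odd (int i + - int j) \<longleftrightarrow> odd (i + j)" by auto
  then show ?thesis
    unfolding N_mat_def factor_def using assms A_eq A_eq' by simp
qed

lemma P_prod_mult_vec1:
  assumes A: "a_array r a A"
  shows "P_prod r A *\<^sub>v vec1 (r + 1) x = vec1 (r + 1) (state (r + 1))"
proof -
  let ?W = "\<lambda>k. mat_prod (r + 1) (map (\<lambda>i. N_mat r A i k) [1..<r + 1])"
  have W: "?W k \<in> carrier_mat (r + 1) (r + 1)" for k
    by (rule mat_prod_carrier) (auto simp: N_mat_def)
  \<comment> \<open>The last \<open>j\<close> rows act first; \<open>j = r + 1\<close> gives the
    whole product.\<close>
  have "mat_prod (r + 1) (map ?W [1 - int j..0]) *\<^sub>v vec1 (r + 1) x = vec1 (r + 1) (state j)"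
    if "j \<le> r + 1" for j
    using that
  proof (induction j)
    case 0
    have "state 0 = x" by auto
    then show ?case by (simp add: mat_prod_Nil_mult_vec[simplified])
  next
    case (Suc j)
    have "map ?W [1 - int (Suc j)..0] = ?W (- int j) # map ?W [1 - int j..0]"
      by (subst upto_rec1) (auto simp del: upt_Suc)
    then have "mat_prod (r + 1) (map ?W [1 - int (Suc j)..0]) *\<^sub>v vec1 (r + 1) x
        = ?W (- int j) *\<^sub>v (mat_prod (r + 1) (map ?W [1 - int j..0]) *\<^sub>v vec1 (r + 1) x)"
      by (simp only:) (rule mat_prod_Cons_mult_vec, use W in auto)
    also have "\<dots> = ?W (- int j) *\<^sub>v vec1 (r + 1) (state j)"
      using Suc by simp
    also have "map (\<lambda>i. N_mat r A i (- int j)) [1..<r + 1] = map (factor j) [1..<r + 1]"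
      using N_mat_eq_factor[OF A] Suc.prems by (intro map_cong) auto
    finally show ?case unfolding row_mult_state .
  qed
  from this[of "r + 1"] show ?thesis by (simp add: P_prod_def)
qed

end

section \<open>Comparison with the factorised right-hand side\<close>

theorem theorem5p16:
  fixes r s e :: nat
    and a :: "nat \<Rightarrow> 'k::field"
    and A :: "nat \<Rightarrow> int \<Rightarrow> 'k"
  assumes "r \<ge> 1"
    and "r = 2 * s + e"
    and "e \<in> {0, 1}"
    and "\<forall>i\<in>{1..r}. a i \<noteq> 0"
    and "a_array r a A"
  defines "L \<equiv> \<lambda>i. U_mat r (2 * i + e) 1 1 ((-1) ^ (e + 1) * a (2 * (s - i) + 1))"
    and "R \<equiv> \<lambda>i. U_mat r (2 * i) 1 1 (a (2 * i))"
  shows "P_prod r A =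
           mat_prod (r + 1) (map L [1 - e..<s + 1]) * P_mat r * mat_prod (r + 1) (map R [1..<s + 1])
       \<and> (\<forall>i\<in>{1 - e..s}. \<forall>j\<in>{1 - e..s}. L i * L j = L j * L i)
       \<and> (\<forall>i\<in>{1..s}. \<forall>j\<in>{1..s}. R i * R j = R j * R i)"
proof (intro conjI ballI)
  fix i j assume "i \<in> {1 - e..s}" "j \<in> {1 - e..s}"
  then show "L i * L j = L j * L i"
    unfolding L_def using assms(1-3) by (intro U_mat_commute) auto
next
  fix i j assume "i \<in> {1..s}" "j \<in> {1..s}"
  then show "R i * R j = R j * R i"
    unfolding R_def using assms(1-3) by (intro U_mat_commute) auto
next
  let ?PL = "mat_prod (r + 1) (map L [1 - e..<s + 1])"
  let ?PR = "mat_prod (r + 1) (map R [1..<s + 1])"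
  have carrier: "?PL \<in> carrier_mat (r + 1) (r + 1)" "?PR \<in> carrier_mat (r + 1) (r + 1)"
      "P_prod r A \<in> carrier_mat (r + 1) (r + 1)" "P_mat r \<in> carrier_mat (r + 1) (r + 1)"
    by (auto simp: P_prod_def L_def R_def N_mat_def intro!: mat_prod_carrier[of _ "Suc r"])
  show "P_prod r A = ?PL * P_mat r * ?PR"
  proof (rule mat_eq_vec1I[of _ "r + 1"])
    fix x :: "nat \<Rightarrow> 'k" assume x: "x 0 = 0" "\<And>p. p > r + 1 \<Longrightarrow> x p = 0"
    interpret sign_T_system r a x using assms x by unfold_locales auto
    \<comment> \<open>\<open>y\<close> is the image of \<open>x\<close> under the right factors, and
      \<open>w\<close> the image of \<open>y\<close> under \<open>P_mat r\<close>. At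
      \<open>p = 1\<close> the term with \<open>a 0\<close> vanishes because
      \<open>x 0 = 0\<close>.\<close>
    define y where "y p = (if odd p then x p + a (p - 1) * x (p - 1) else x p)" for p
    define w where "w p = (-1) ^ ((r - 1) * (p - 1)) * y (r + 2 - p)" for p
    have "?PR *\<^sub>v vec1 (r + 1) x = vec1 (r + 1)
        (\<lambda>p. if p - 1 \<in> (*) 2 ` set [1..<s + 1] then x p + a (p - 1) * x (p - 1) else x p)"
      unfolding R_def using assms(2)
      by (intro mat_prod_U_mat_mult_vec1) (auto simp: distinct_map inj_on_def simp del: upt_Suc)
    also have "\<dots> = vec1 (r + 1) y"
    proof (rule vec1_cong)
      fix p assume p: "1 \<le> p" "p \<le> r + 1"
      show "(if p - 1 \<in> (*) 2 ` set [1..<s + 1] then x p + a (p - 1) * x (p - 1) else x p) = y p"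
      proof (cases "odd p \<and> p \<noteq> 1")
        case True
        then obtain k where k: "p = 2 * k + 1" by (auto elim: oddE)
        then have "k \<in> set [1..<s + 1]" "p - 1 = 2 * k"
          using True p assms(2,3) by (auto simp del: upt_Suc)
        then show ?thesis using True by (auto simp: y_def simp del: upt_Suc)
      next
        case False
        have "p - 1 \<notin> (*) 2 ` set [1..<s + 1]"
        proof
          assume "p - 1 \<in> (*) 2 ` set [1..<s + 1]"
          then obtain i where "1 \<le> i" "p - 1 = 2 * i" by auto
          then have "p = 2 * i + 1" "i \<noteq> 0" by auto
          then show False using False by simp
        qed
        moreover have "y p = x p" using False x by (auto simp: y_def)
        ultimately show ?thesis by simp
      qed
    qed
    finally have PR: "?PR *\<^sub>v vec1 (r + 1) x = vec1 (r + 1) y" .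
    \<comment> \<open>As \<open>r = 2 * s + e\<close>, the index \<open>2 * (s - i) + 1\<close> is
      \<open>r + 1\<close> minus the position \<open>2 * i + e\<close>, so the coefficient depends
      on the position alone.\<close>
    have L_eq: "map L [1 - e..<s + 1] = map (\<lambda>i. U_mat r (2 * i + e) 1 1
        ((\<lambda>m. (-1) ^ (e + 1) * a (r + 1 - m)) (2 * i + e))) [1 - e..<s + 1]"
      unfolding L_def using assms(2)
      by (intro map_cong refl) (auto simp: Suc_diff_le diff_mult_distrib2)
    have PL: "?PL *\<^sub>v vec1 (r + 1) w = vec1 (r + 1)
        (\<lambda>p. if p - 1 \<in> (\<lambda>i. 2 * i + e) ` set [1 - e..<s + 1]
          then w p + (-1) ^ (e + 1) * a (r + 1 - (p - 1)) * w (p - 1) else w p)"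
      unfolding L_eq using assms(2,3)
      by (subst mat_prod_U_mat_mult_vec1) (auto simp: distinct_map inj_on_def simp del: upt_Suc)
    have "P_prod r A *\<^sub>v vec1 (r + 1) x = vec1 (r + 1) (state (r + 1))"
      by (rule P_prod_mult_vec1) fact
    also have "\<dots> = ?PL *\<^sub>v vec1 (r + 1) w"
      unfolding PL
    proof (rule vec1_cong)
      fix p assume p: "1 \<le> p" "p \<le> r + 1"
      \<comment> \<open>The left factors change only coordinates \<open>p\<close> with
        \<open>p + r\<close> odd. For \<open>q + r\<close> even, \<open>(r - 1) * (q - 1)\<close>
        and \<open>r * q + 1\<close> have the same parity, so the signs agree.\<close>
      have w_moved: "w q = state (r + 1) q" if q: "even (q + r)" "1 \<le> q" "q \<le> r + 1" for q
      proof -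
        have "y (r + 2 - q) = x (r + 2 - q)" using q by (simp add: y_def)
        moreover have "(-1 :: 'k) ^ ((r - 1) * (q - 1)) = - ((-1) ^ (r * q))"
          using q assms(1) by (auto simp: minus_one_power_iff)
        ultimately show ?thesis using final_state_moved_parity[of q] q by (simp add: w_def)
      qed
      show "state (r + 1) p = (if p - 1 \<in> (\<lambda>i. 2 * i + e) ` set [1 - e..<s + 1]
          then w p + (-1) ^ (e + 1) * a (r + 1 - (p - 1)) * w (p - 1) else w p)"
      proof (cases "even (p + r)")
        case True
        then have "p - 1 \<notin> (\<lambda>i. 2 * i + e) ` set [1 - e..<s + 1]"
          using p assms(2) by (auto simp del: upt_Suc) presburger+
        then show ?thesis using w_moved[OF True p] by simp
      next
        case False
        let ?n = "r + 2 - p"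
        have "odd ?n" using False p by auto
        then have y: "y ?n = x ?n + a (?n - 1) * x (?n - 1)" by (simp add: y_def)
        have "(-1 :: 'k) ^ ((r - 1) * (p - 1)) = (-1) ^ (r * p)"
          using False p assms(1) by (auto simp: minus_one_power_iff)
        then have st: "state (r + 1) p = w p + (-1) ^ (r + 1) * a ?n * state (r + 1) (p - 1)"
          using final_state_fixed_parity[OF p False refl] y by (simp add: w_def)
        show ?thesis
        proof (cases "p = 1")
          case True
          then have "p - 1 \<notin> (\<lambda>i. 2 * i + e) ` set [1 - e..<s + 1]"
            using False assms(2,3) by (auto simp del: upt_Suc)
          then show ?thesis using st True by simp
        next
          case p1: False
          \<comment> \<open>\<open>p - 1\<close> has the parity of \<open>r\<close>, hence of
            \<open>e\<close>; its least positive value is 2 for \<open>e = 0\<close> and 1 for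
            \<open>e = 1\<close>, matching the lower index bound \<open>1 - e\<close>.\<close>
          have "p - 1 = 2 * ((p - 1 - e) div 2) + e" "(p - 1 - e) div 2 \<in> set [1 - e..<s + 1]"
            using p p1 False assms(2,3) by (auto simp del: upt_Suc) presburger+
          then have "p - 1 \<in> (\<lambda>i. 2 * i + e) ` set [1 - e..<s + 1]" by blast
          moreover have "w (p - 1) = state (r + 1) (p - 1)"
            using p p1 False by (intro w_moved) auto
          moreover have "(-1 :: 'k) ^ (e + 1) = (-1) ^ (r + 1)"
            using assms(2) by (simp add: minus_one_power_iff)
          moreover have "r + 1 - (p - 1) = ?n" using p by simp
          ultimately show ?thesis using st by simp
        qed
      qed
    qed
    also have "\<dots> = ?PL * P_mat r * ?PR *\<^sub>v vec1 (r + 1) x"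
    proof -
      have "?PL * P_mat r * ?PR *\<^sub>v vec1 (r + 1) x = ?PL *\<^sub>v (P_mat r *\<^sub>v (?PR *\<^sub>v vec1 (r + 1) x))"
        using carrier by (simp add: assoc_mult_mat_vec[of _ "Suc r" "Suc r" _ "Suc r"])
      then show ?thesis unfolding PR P_mat_mult_vec1 w_def by simp
    qed
    finally show "P_prod r A *\<^sub>v vec1 (r + 1) x = ?PL * P_mat r * ?PR *\<^sub>v vec1 (r + 1) x" .
  qed (use carrier in auto)
qed

end
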